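(* Let $\mathcal{K}\subseteq\mathbb{R}^n$ be a convex body symmetric with respect to a point $o$, and let $m\ge0$ be an integer. Then $\psi_m(\mathcal{K})\ge\psi_m(\mathbb{B}_2^n)$.
   Context: A convex body is a compact convex set with nonempty interior. A set $\mathcal{K}$ is $o$-symmetric if $x\in\mathcal{K}$ implies $2o-x\in\mathcal{K}$. For an $o$-symmetric convex body $\mathcal{K}$, $\psi_m(\mathcal{K})=\sup\{\operatorname{vol}\mathcal{P}/\operatorname{vol}\mathcal{K}\colon \mathcal{P}\subset\mathcal{K}\text{ a convex polytope with at most } m \text{ vertices that is } o\text{-symmetric}\}$. $\mathbb{B}_2^n$ is the Euclidean unit ball, considered as symmetric about its center (the origin). *)

theory Defs
  imports "HOL-Analysis.Analysis"
begin

definition convex_body :: "'a::euclidean_space set \<Rightarrow> bool" where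
  "convex_body K \<longleftrightarrow> compact K \<and> convex K \<and> interior K \<noteq> {}"

definition symmetric_about :: "'a::euclidean_space \<Rightarrow> 'a set \<Rightarrow> bool" where
  "symmetric_about c K \<longleftrightarrow> (\<forall>x\<in>K. (2::real) *\<^sub>R c - x \<in> K)"

text \<open>Convex polytopes with at most m vertices are exactly convex hulls of
  at most m points.\<close>
definition psi :: "nat \<Rightarrow> 'a::euclidean_space \<Rightarrow> 'a set \<Rightarrow> real" where
  "psi m c K = Sup {measure lebesgue P / measure lebesgue K | P.
      \<exists>S. finite S \<and> card S \<le> m \<and> P = convex hull S \<and> P \<subseteq> K \<and> symmetric_about c P}"

end

theory Submission
  imports Defs
begin

text \<open>Macbeath's argument by Steiner symmetrization. Symmetrizing a body does not increase the largest
  volume of an inscribed symmetric polytope: a polytope inscribed in the symmetral is, along every line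
  of the given direction, at most the average of two polytopes inscribed in the body. Moreover some
  symmetrization enlarges the intersection with the centred ball \<open>B\<close> of equal volume: averaging over
  translations \<open>h\<close> finds one that carries a part of \<open>K - B\<close> of volume at least a constant times
  \<open>vol (K - B)\<^sup>2\<close> into \<open>B - K\<close>, and symmetrizing in direction \<open>h\<close> gains that volume.
  Hence suitable iterates contain balls almost as large as \<open>B\<close>, and the ball's polytopes,
  slightly shrunk, fit into them.\<close>

section \<open>Slices along parallel lines and Cavalieri's principle\<close>

definition slice :: "'a::euclidean_space \<Rightarrow> 'a \<Rightarrow> 'a set \<Rightarrow> real set" where
  "slice u x S = {t. x + t *\<^sub>R u \<in> S}"

definition reflect :: "'a::euclidean_space \<Rightarrow> 'a \<Rightarrow> 'a" where
  "reflect u x = x - (2 * (x \<bullet> u)) *\<^sub>R u"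

text \<open>The Minkowski average taken separately on each line parallel to \<open>u\<close>. Two
  sets are allowed because a polytope in a symmetral is compared with an average of two different
  hulls.\<close>

definition fibre_avg :: "'a::euclidean_space \<Rightarrow> 'a set \<Rightarrow> 'a set \<Rightarrow> 'a set" where
  "fibre_avg u A B = {(1/2) *\<^sub>R (p + q) |p q. p \<in> A \<and> q \<in> B \<and> p - q \<in> span {u}}"

text \<open>If \<^term>\<open>K\<close> meets a line parallel to the unit vector \<^term>\<open>u\<close> in parameters \<open>[a, b]\<close>, the
  reflection meets it in \<open>[-b, -a]\<close> (measured from the hyperplane orthogonal to \<^term>\<open>u\<close>), and the
  average of the two is the centred interval of length \<open>b - a\<close>.\<close>

definition steiner :: "'a::euclidean_space \<Rightarrow> 'a set \<Rightarrow> 'a set" where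
  "steiner u K = fibre_avg u K (reflect u ` K)"

lemma slice_borel [measurable]:
  assumes "S \<in> sets borel"
  shows "slice u x S \<in> sets borel"
proof -
  have "(\<lambda>t. x + t *\<^sub>R u) -` S \<inter> space borel \<in> sets borel"
    using assms by (intro measurable_sets[of _ borel borel]) auto
  then show ?thesis by (simp add: slice_def vimage_def)
qed

lemma emeasure_slice:
  assumes "S \<in> sets borel"
  shows "emeasure lborel (slice u x S) = (\<integral>\<^sup>+t. indicator S (x + t *\<^sub>R u) \<partial>lborel)"
proof -
  have "emeasure lborel (slice u x S) = (\<integral>\<^sup>+t. indicator (slice u x S) t \<partial>lborel)"
    using assms by (subst nn_integral_indicator) auto
  also have "\<dots> = (\<integral>\<^sup>+t. indicator S (x + t *\<^sub>R u) \<partial>lborel)"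
    by (intro nn_integral_cong) (simp add: slice_def indicator_def)
  finally show ?thesis .
qed

lemma nn_integral_lborel_translate:
  fixes f :: "'a::euclidean_space \<Rightarrow> ennreal"
  assumes [measurable]: "f \<in> borel_measurable borel"
  shows "(\<integral>\<^sup>+x. f (c + x) \<partial>lborel) = (\<integral>\<^sup>+x. f x \<partial>lborel)"
proof -
  have "(\<integral>\<^sup>+x. f x \<partial>lborel) = (\<integral>\<^sup>+x. f x \<partial>distr lborel borel ((+) c))"
    by (simp add: lborel_distr_plus)
  also have "\<dots> = (\<integral>\<^sup>+x. f (c + x) \<partial>lborel)"
    by (subst nn_integral_distr) auto
  finally show ?thesis ..
qed

lemma emeasure_slice_measurable [measurable]:
  assumes [measurable]: "S \<in> sets borel"
  shows "(\<lambda>x. emeasure lborel (slice u x S)) \<in> borel_measurable borel"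
  unfolding emeasure_slice[OF assms] by measurable

text \<open>A Fubini formula along lines parallel to \<^term>\<open>u\<close>. Integrating over a slab of width one,
  instead of over the hyperplane orthogonal to \<^term>\<open>u\<close>, makes translation invariance
  sufficient: no change of coordinates is needed.\<close>

lemma emeasure_eq_nn_integral_slice:
  fixes S :: "'a::euclidean_space set"
  assumes u: "norm u = 1" and S [measurable]: "S \<in> sets borel"
  shows "emeasure lborel S =
    (\<integral>\<^sup>+x. indicator {x. 0 \<le> x \<bullet> u \<and> x \<bullet> u < 1} x * emeasure lborel (slice u x S) \<partial>lborel)"
proof -
  define D where "D = {x::'a. 0 \<le> x \<bullet> u \<and> x \<bullet> u < 1}"
  have [measurable]: "D \<in> sets borel" unfolding D_def by measurable
  have "(\<integral>\<^sup>+x. indicator D x * emeasure lborel (slice u x S) \<partial>lborel)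
      = (\<integral>\<^sup>+x. \<integral>\<^sup>+t. indicator D x * indicator S (x + t *\<^sub>R u) \<partial>lborel \<partial>lborel)"
    unfolding emeasure_slice[OF S] by (subst nn_integral_cmult) auto
  also have "\<dots> = (\<integral>\<^sup>+t. \<integral>\<^sup>+x. indicator D x * indicator S (x + t *\<^sub>R u) \<partial>lborel \<partial>lborel)"
    by (rule lborel_pair.Fubini'[symmetric]) measurable
  \<comment> \<open>For fixed \<open>t\<close>, translation in \<open>x\<close> moves the parameter
    from \<open>S\<close> to the slab.\<close>
  also have "\<dots> = (\<integral>\<^sup>+t. \<integral>\<^sup>+x. indicator D (x - t *\<^sub>R u) * indicator S x \<partial>lborel \<partial>lborel)"
  proof (rule nn_integral_cong)
    fix t :: real
    show "(\<integral>\<^sup>+x. indicator D x * indicator S (x + t *\<^sub>R u) \<partial>lborel)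
        = (\<integral>\<^sup>+x. indicator D (x - t *\<^sub>R u) * (indicator S x :: ennreal) \<partial>lborel)"
      using nn_integral_lborel_translate[of
          "\<lambda>x. indicator D (x - t *\<^sub>R u) * (indicator S x :: ennreal)" "t *\<^sub>R u"]
      by (simp add: add.commute)
  qed
  also have "\<dots> = (\<integral>\<^sup>+x. \<integral>\<^sup>+t. indicator D (x - t *\<^sub>R u) * indicator S x \<partial>lborel \<partial>lborel)"
    by (rule lborel_pair.Fubini') measurable
  \<comment> \<open>As \<open>u\<close> is a unit vector, each line parallel to it stays in the slab
    for a half-open parameter interval of length one.\<close>
  also have "\<dots> = (\<integral>\<^sup>+x. indicator S x \<partial>lborel)"
  proof (rule nn_integral_cong)
    fix x :: 'a
    have uu: "u \<bullet> u = 1" using u by (simp add: norm_eq_1)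
    have "(\<integral>\<^sup>+t. indicator D (x - t *\<^sub>R u) * (indicator S x :: ennreal) \<partial>lborel)
       = (\<integral>\<^sup>+t. indicator {x \<bullet> u - 1<..x \<bullet> u} t * (indicator S x :: ennreal) \<partial>lborel)"
      by (intro nn_integral_cong) (auto simp: D_def indicator_def inner_diff_left uu)
    also have "\<dots> = indicator S x"
      by (subst nn_integral_multc) auto
    finally show "(\<integral>\<^sup>+t. indicator D (x - t *\<^sub>R u) * (indicator S x :: ennreal) \<partial>lborel) = indicator S x" .
  qed
  also have "\<dots> = emeasure lborel S" by simp
  finally show ?thesis unfolding D_def ..
qed

lemma emeasure_le_of_slice_le:
  fixes S T :: "'a::euclidean_space set"
  assumes "norm u = 1" "S \<in> sets borel" "T \<in> sets borel"
    and "\<And>x. emeasure lborel (slice u x S) \<le> emeasure lborel (slice u x T)"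
  shows "emeasure lborel S \<le> emeasure lborel T"
  unfolding emeasure_eq_nn_integral_slice[OF assms(1,2)] emeasure_eq_nn_integral_slice[OF assms(1,3)]
  by (intro nn_integral_mono mult_left_mono assms(4)) auto

text \<open>Integrates the slice inequality over the slab. The factor 2 on the left keeps division
  out of the extended nonnegative reals.\<close>

lemma emeasure_double_le_of_slice_le:
  fixes S T T' :: "'a::euclidean_space set"
  assumes "norm u = 1" and [measurable]: "S \<in> sets borel" "T \<in> sets borel" "T' \<in> sets borel"
    and le: "\<And>x. 2 * emeasure lborel (slice u x S)
              \<le> emeasure lborel (slice u x T) + emeasure lborel (slice u x T')"
  shows "2 * emeasure lborel S \<le> emeasure lborel T + emeasure lborel T'"
proof -
  let ?D = "{x. 0 \<le> x \<bullet> u \<and> x \<bullet> u < 1}"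
  have "2 * emeasure lborel S = (\<integral>\<^sup>+x. indicator ?D x * (2 * emeasure lborel (slice u x S)) \<partial>lborel)"
    by (subst emeasure_eq_nn_integral_slice[OF assms(1,2)], subst nn_integral_cmult[symmetric])
       (auto simp: mult_ac)
  also have "\<dots> \<le> (\<integral>\<^sup>+x. indicator ?D x * emeasure lborel (slice u x T)
                     + indicator ?D x * emeasure lborel (slice u x T') \<partial>lborel)"
    by (intro nn_integral_mono) (auto simp: le indicator_def)
  also have "\<dots> = emeasure lborel T + emeasure lborel T'"
    by (subst nn_integral_add)
       (auto simp: emeasure_eq_nn_integral_slice[OF assms(1,3)] emeasure_eq_nn_integral_slice[OF assms(1,4)])
  finally show ?thesis .
qed

section \<open>Slices of compact convex sets and of reflected sets\<close>

lemma slice_convex: "convex S \<Longrightarrow> convex (slice u x S)"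
proof -
  assume S: "convex S"
  have "slice u x S = (\<lambda>t. t *\<^sub>R u) -` ((+) (- x) ` S)"
    by (force simp: slice_def image_iff algebra_simps)
  moreover have "convex ((\<lambda>t. t *\<^sub>R u) -` ((+) (- x) ` S))"
    using S by (intro convex_linear_vimage linear_scaleR_left convex_translation)
       (auto simp: linear_iff algebra_simps)
  ultimately show ?thesis by simp
qed

lemma slice_compact:
  assumes "compact S" "norm u = 1"
  shows "compact (slice u x S)"
proof -
  have "closed (slice u x S)"
    unfolding slice_def using compact_imp_closed[OF assms(1)]
    by (intro continuous_closed_vimage[of S "\<lambda>t. x + t *\<^sub>R u", unfolded vimage_def]) auto
  moreover obtain B where B: "\<And>y. y \<in> S \<Longrightarrow> norm y \<le> B"
    using compact_imp_bounded[OF assms(1)] by (auto simp: bounded_iff)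
  have "\<bar>t\<bar> \<le> B + norm x" if "t \<in> slice u x S" for t
  proof -
    have "\<bar>t\<bar> = norm ((x + t *\<^sub>R u) - x)" using assms(2) by simp
    also have "\<dots> \<le> norm (x + t *\<^sub>R u) + norm x" by (rule norm_triangle_ineq4)
    also have "\<dots> \<le> B + norm x" using B that by (simp add: slice_def)
    finally show ?thesis .
  qed
  then have "bounded (slice u x S)" unfolding bounded_iff by (metis real_norm_def)
  ultimately show ?thesis by (simp add: compact_eq_bounded_closed)
qed

text \<open>Compact connected sets of reals are closed intervals; an empty slice appears with
  \<open>b < a\<close>.\<close>

lemma slice_interval:
  assumes "compact S" "convex S" "norm u = 1"
  obtains a b where "slice u x S = {a..b}"
  using connected_compact_interval_1[of "slice u x S"] slice_compact[OF assms(1,3)]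
    slice_convex[OF assms(2)] convex_connected
  by (metis box_real(2))

text \<open>The line meets the hyperplane orthogonal to \<open>u\<close> at parameter
  \<open>- (x \<bullet> u)\<close>, and the reflection flips parameters about that point.\<close>

lemma slice_reflect:
  assumes "norm u = 1"
  shows "slice u x (reflect u ` S) = (\<lambda>t. - 2 * (x \<bullet> u) - t) ` slice u x S"
proof -
  have uu: "u \<bullet> u = 1" using assms by (simp add: norm_eq_1)
  have r: "reflect u (x + t *\<^sub>R u) = x + (- 2 * (x \<bullet> u) - t) *\<^sub>R u" for t
  proof -
    have e: "- 2 * (x \<bullet> u) - t = t - 2 * (x \<bullet> u + t)" by simp
    show ?thesis
      unfolding e reflect_def scaleR_left_diff_distrib inner_add_left inner_scaleR_left uu by simp
  qed
  have rr: "reflect u (reflect u y) = y" for y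
    by (simp add: reflect_def inner_diff_left uu algebra_simps)
  have "s \<in> slice u x (reflect u ` S) \<longleftrightarrow> - 2 * (x \<bullet> u) - s \<in> slice u x S" for s
    unfolding slice_def mem_Collect_eq r[symmetric] image_iff by (metis rr)
  moreover have "s \<in> (\<lambda>t. - 2 * (x \<bullet> u) - t) ` A \<longleftrightarrow> - 2 * (x \<bullet> u) - s \<in> A" for s A
    by (auto simp: image_iff intro!: bexI[of _ "- 2 * (x \<bullet> u) - s"])
  ultimately show ?thesis by blast
qed

section \<open>Fibrewise averages\<close>

lemma fibre_avgI:
  "\<lbrakk>p \<in> A; q \<in> B; p - q \<in> span {u}; v = (1/2) *\<^sub>R (p + q)\<rbrakk> \<Longrightarrow> v \<in> fibre_avg u A B"
  unfolding fibre_avg_def by blast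

text \<open>Two points whose difference is a multiple of \<open>u\<close> lie on the line of their
  midpoint, so everything reduces to Minkowski averages of subsets of the reals.\<close>

lemma slice_fibre_avg:
  assumes "norm u = 1"
  shows "slice u x (fibre_avg u A B) = {(a + b) / 2 |a b. a \<in> slice u x A \<and> b \<in> slice u x B}"
proof (intro set_eqI iffI)
  fix t assume "t \<in> slice u x (fibre_avg u A B)"
  then obtain p q k where h: "x + t *\<^sub>R u = (1/2) *\<^sub>R (p + q)" "p \<in> A" "q \<in> B" "p - q = k *\<^sub>R u"
    by (auto simp: slice_def fibre_avg_def span_singleton)
  \<comment> \<open>Sum and difference determine both points: they have parameters
    \<open>t + k/2\<close> and \<open>t - k/2\<close>.\<close>
  have "p + q = 2 *\<^sub>R (x + t *\<^sub>R u)" by (simp add: h(1))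
  moreover have "2 *\<^sub>R p = (p + q) + (p - q)" "2 *\<^sub>R q = (p + q) - (p - q)"
    by (simp_all add: scaleR_2)
  ultimately have "2 *\<^sub>R p = 2 *\<^sub>R (x + (t + k/2) *\<^sub>R u)" "2 *\<^sub>R q = 2 *\<^sub>R (x + (t - k/2) *\<^sub>R u)"
    unfolding h(4) by (simp_all add: algebra_simps)
  then have "p = x + (t + k/2) *\<^sub>R u" "q = x + (t - k/2) *\<^sub>R u" by (metis scaleR_cancel_left zero_neq_numeral)+
  then show "t \<in> {(a + b) / 2 |a b. a \<in> slice u x A \<and> b \<in> slice u x B}"
    using h(2,3) by (intro CollectI exI[of _ "t + k/2"] exI[of _ "t - k/2"]) (simp add: slice_def)
next
  fix t assume "t \<in> {(a + b) / 2 |a b. a \<in> slice u x A \<and> b \<in> slice u x B}"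
  then obtain a b where h: "t = (a + b) / 2" "x + a *\<^sub>R u \<in> A" "x + b *\<^sub>R u \<in> B"
    by (auto simp: slice_def)
  have "x + t *\<^sub>R u = (1/2) *\<^sub>R ((x + a *\<^sub>R u) + (x + b *\<^sub>R u))"
    by (simp add: h(1) algebra_simps add_divide_distrib flip: scaleR_2)
  moreover have "(x + a *\<^sub>R u) - (x + b *\<^sub>R u) \<in> span {u}"
    by (auto simp: span_singleton scaleR_left_diff_distrib[symmetric])
  ultimately show "t \<in> slice u x (fibre_avg u A B)"
    using h(2,3) by (auto simp: slice_def intro: fibre_avgI)
qed

lemma interval_average:
  fixes a b c d :: real
  assumes "a \<le> b" "c \<le> d"
  shows "{(s + t) / 2 |s t. s \<in> {a..b} \<and> t \<in> {c..d}} = {(a + c) / 2..(b + d) / 2}"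
proof (intro set_eqI iffI)
  fix r assume r: "r \<in> {(a + c) / 2..(b + d) / 2}"
  \<comment> \<open>This clamps \<open>2 * r - c\<close> to \<open>[a, b]\<close>: the partner
    \<open>2 * r - s\<close> is then \<open>c\<close>, or \<open>2 * r - b\<close> if
    \<open>s = b\<close>.\<close>
  define s where "s = max a (min b (2 * r - c))"
  have "r = (s + (2 * r - s)) / 2 \<and> s \<in> {a..b} \<and> 2 * r - s \<in> {c..d}"
    using r assms by (auto simp: s_def max_def min_def field_simps)
  then show "r \<in> {(s + t) / 2 |s t. s \<in> {a..b} \<and> t \<in> {c..d}}" by blast
qed (auto simp: field_simps)

text \<open>As a linear image of a linear section of \<open>A \<times> B\<close>, the average
  inherits convexity and compactness.\<close>

lemma fibre_avg_image:
  "fibre_avg u A B = (\<lambda>(p, q). (1/2) *\<^sub>R (p + q)) ` ((A \<times> B) \<inter> (\<lambda>(p, q). p - q) -` span {u})"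
  by (force simp: fibre_avg_def)

lemma fibre_avg_convex:
  assumes "convex A" "convex B"
  shows "convex (fibre_avg u A B)"
  unfolding fibre_avg_image
  using assms
  by (intro convex_linear_image convex_Int convex_Times convex_linear_vimage
        subspace_imp_convex[OF subspace_span])
     (auto simp: linear_iff algebra_simps)

lemma fibre_avg_compact:
  assumes "compact A" "compact B"
  shows "compact (fibre_avg u A B)"
  unfolding fibre_avg_image
  using assms
  by (intro compact_continuous_image compact_Int_closed compact_Times closed_vimage closed_subspace subspace_span)
     (auto simp: split_beta intro!: continuous_intros)

text \<open>Lengths of nonempty intervals add under Minkowski sums. A single empty slice would empty
  the average, whatever the length of the other.\<close>

lemma emeasure_slice_fibre_avg:
  assumes "compact A" "convex A" "compact B" "convex B" "norm u = 1"
    and ne: "slice u x A \<noteq> {}" "slice u x B \<noteq> {}"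
  shows "2 * emeasure lborel (slice u x (fibre_avg u A B))
       = emeasure lborel (slice u x A) + emeasure lborel (slice u x B)"
proof -
  obtain a b where A: "slice u x A = {a..b}" using slice_interval assms by blast
  obtain c d where B: "slice u x B = {c..d}" using slice_interval assms by blast
  have le: "a \<le> b" "c \<le> d" using ne by (auto simp: A B)
  have "slice u x (fibre_avg u A B) = {(a + c) / 2..(b + d) / 2}"
    unfolding slice_fibre_avg[OF assms(5)] A B by (rule interval_average[OF le])
  moreover have "(2::ennreal) * ennreal ((b + d) / 2 - (a + c) / 2) = ennreal (b - a) + ennreal (d - c)"
  proof -
    have "(2::ennreal) * ennreal ((b + d) / 2 - (a + c) / 2) = ennreal (2 * ((b + d) / 2 - (a + c) / 2))"
      using le by (subst ennreal_mult) auto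
    also have "2 * ((b + d) / 2 - (a + c) / 2) = (b - a) + (d - c)" by (simp add: field_simps)
    also have "ennreal \<dots> = ennreal (b - a) + ennreal (d - c)" using le by (intro ennreal_plus) auto
    finally show ?thesis .
  qed
  ultimately show ?thesis using le by (simp add: A B)
qed

text \<open>Lines meeting both sets give equality; lines meeting only one contribute to the
  right-hand side alone.\<close>

lemma emeasure_fibre_avg_le:
  fixes A B :: "'a::euclidean_space set"
  assumes "compact A" "convex A" "compact B" "convex B" "norm u = 1"
  shows "2 * emeasure lborel (fibre_avg u A B) \<le> emeasure lborel A + emeasure lborel B"
proof (rule emeasure_double_le_of_slice_le[OF assms(5)])
  fix x
  show "2 * emeasure lborel (slice u x (fibre_avg u A B))
       \<le> emeasure lborel (slice u x A) + emeasure lborel (slice u x B)"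
  proof (cases "slice u x A = {} \<or> slice u x B = {}")
    case True
    then have "slice u x (fibre_avg u A B) = {}" unfolding slice_fibre_avg[OF assms(5)] by auto
    then show ?thesis by simp
  qed (simp add: emeasure_slice_fibre_avg assms)
qed (auto intro: borel_compact fibre_avg_compact assms)

section \<open>Reflections preserve volume\<close>

lemma emeasure_lborel_real_affine:
  fixes m c :: real
  assumes "S \<in> sets borel" "m \<noteq> 0"
  shows "emeasure lborel ((\<lambda>t. m * t + c) ` S) = ennreal \<bar>m\<bar> * emeasure lborel S"
proof -
  have "(\<lambda>t. m * t + c) ` S = (\<lambda>t. t / m - c / m) -` S"
    using assms(2) by (force simp: image_iff field_simps)
  also have "\<dots> \<in> sets borel"
    using measurable_sets[of "\<lambda>t. t / m - c / m" borel borel S] assms by simp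
  finally have "(\<lambda>t. m * t + c) ` S \<in> sets borel" .
  then show ?thesis
    using emeasure_lebesgue_affine[of m c S] assms by (simp add: image_def)
qed

lemma emeasure_slice_reflect:
  assumes "norm u = 1" "S \<in> sets borel"
  shows "emeasure lborel (slice u x (reflect u ` S)) = emeasure lborel (slice u x S)"
proof -
  have "slice u x (reflect u ` S) = (\<lambda>t. -1 * t + - 2 * (x \<bullet> u)) ` slice u x S"
    unfolding slice_reflect[OF assms(1)] by (rule image_cong) auto
  then show ?thesis
    using emeasure_lborel_real_affine[of "slice u x S" "-1" "- 2 * (x \<bullet> u)"] slice_borel[OF assms(2)]
    by simp
qed

lemma linear_reflect: "linear (reflect u)"
  by (auto simp: linear_iff reflect_def inner_add_left algebra_simps)

lemma norm_reflect: "norm u = 1 \<Longrightarrow> norm (reflect u x) = norm x"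
  by (simp add: norm_eq_sqrt_inner reflect_def inner_diff_left inner_diff_right norm_eq_1 inner_commute
      algebra_simps)

lemma compact_reflect: "compact S \<Longrightarrow> compact (reflect u ` S)"
  by (intro compact_continuous_image linear_continuous_on linear_linear[THEN iffD2] linear_reflect)

lemma convex_reflect: "convex S \<Longrightarrow> convex (reflect u ` S)"
  by (intro convex_linear_image linear_reflect)

text \<open>Corresponding slices have equal length, so Cavalieri's principle applies in both
  directions and no determinant is computed.\<close>

lemma emeasure_reflect:
  assumes "norm u = 1" "compact S"
  shows "emeasure lborel (reflect u ` S) = emeasure lborel S"
  using assms
  by (intro antisym emeasure_le_of_slice_le[OF assms(1)] borel_compact compact_reflect)
     (simp_all add: emeasure_slice_reflect borel_compact)

section \<open>Steiner symmetrals\<close>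

lemma steiner_compact: "compact K \<Longrightarrow> compact (steiner u K)"
  unfolding steiner_def by (intro fibre_avg_compact compact_reflect)

lemma steiner_convex: "convex K \<Longrightarrow> convex (steiner u K)"
  unfolding steiner_def by (intro fibre_avg_convex convex_reflect)

lemma steinerE:
  assumes "v \<in> steiner u K"
  obtains p q where "p \<in> K" "q \<in> K" "v = (1/2) *\<^sub>R (p + reflect u q)" "p - reflect u q \<in> span {u}"
  using assms unfolding steiner_def fibre_avg_def by blast

text \<open>Reflections are isometries and balls are convex. This keeps all iterates in one fixed
  ball, which makes the gain per symmetrization uniform.\<close>

lemma steiner_subset_cball:
  assumes "K \<subseteq> cball 0 R" "norm u = 1"
  shows "steiner u K \<subseteq> cball 0 R"
proof
  fix v assume "v \<in> steiner u K"
  then obtain p q where h: "p \<in> K" "q \<in> K" "v = (1/2) *\<^sub>R (p + reflect u q)"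
    using steinerE by metis
  have "norm p \<le> R" "norm (reflect u q) \<le> R" using h assms by (auto simp: norm_reflect)
  then show "v \<in> cball 0 R"
    using norm_triangle_ineq[of p "reflect u q"] by (simp add: h(3))
qed

text \<open>Negation commutes with the reflection, so negating both averaged points negates the
  average.\<close>

lemma steiner_uminus:
  assumes sym: "\<And>x. x \<in> K \<Longrightarrow> - x \<in> K" and "v \<in> steiner u K"
  shows "- v \<in> steiner u K"
proof -
  obtain p q where h: "p \<in> K" "q \<in> K" "v = (1/2) *\<^sub>R (p + reflect u q)" "p - reflect u q \<in> span {u}"
    using steinerE assms(2) by metis
  have neg: "reflect u (- q) = - reflect u q" by (rule linear_neg[OF linear_reflect])
  show ?thesis
    unfolding steiner_def
  proof (rule fibre_avgI)
    show "- p \<in> K" "reflect u (- q) \<in> reflect u ` K" using sym h by auto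
    show "- p - reflect u (- q) \<in> span {u}" using span_neg[OF h(4)] by (simp add: neg)
    show "- v = (1/2) *\<^sub>R (- p + reflect u (- q))" by (simp add: neg h(3) algebra_simps)
  qed
qed

text \<open>The two averaged intervals, a slice and its mirror image, have the same length.\<close>

lemma emeasure_slice_steiner:
  assumes K: "compact K" "convex K" and u: "norm u = 1"
  shows "emeasure lborel (slice u x (steiner u K)) = emeasure lborel (slice u x K)"
proof (cases "slice u x K = {}")
  case True
  then show ?thesis by (simp add: steiner_def slice_fibre_avg[OF u])
next
  case False
  then have ne: "slice u x (reflect u ` K) \<noteq> {}" by (simp add: slice_reflect[OF u])
  have "2 * emeasure lborel (slice u x (steiner u K)) = 2 * emeasure lborel (slice u x K)"
    unfolding steiner_def
    unfolding emeasure_slice_fibre_avg[OF K compact_reflect[OF K(1)] convex_reflect[OF K(2)] u False ne]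
      emeasure_slice_reflect[OF u borel_compact[OF K(1)]]
    by (rule mult_2[symmetric])
  then show ?thesis by (simp add: ennreal_mult_cancel_left)
qed

lemma emeasure_steiner:
  assumes "compact K" "convex K" and "norm u = 1"
  shows "emeasure lborel (steiner u K) = emeasure lborel K"
  using assms
  by (intro antisym emeasure_le_of_slice_le[OF assms(3)] borel_compact steiner_compact)
     (simp_all add: emeasure_slice_steiner)

text \<open>Exchanging the roles of the two averaged points mirrors their average.\<close>

lemma slice_steiner_reflect:
  assumes u: "norm u = 1" and t: "t \<in> slice u x (steiner u K)"
  shows "- 2 * (x \<bullet> u) - t \<in> slice u x (steiner u K)"
proof -
  obtain a b where h: "t = (a + (- 2 * (x \<bullet> u) - b)) / 2" "a \<in> slice u x K" "b \<in> slice u x K"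
    using t unfolding steiner_def slice_fibre_avg[OF u] slice_reflect[OF u] by blast
  have "- 2 * (x \<bullet> u) - t = (b + (- 2 * (x \<bullet> u) - a)) / 2"
    by (simp add: h(1) field_simps)
  then show ?thesis
    unfolding steiner_def slice_fibre_avg[OF u] slice_reflect[OF u] using h by blast
qed

section \<open>Gaining volume inside a centred ball\<close>

lemma slice_cball:
  assumes u: "norm u = 1"
  shows "t \<in> slice u x (cball 0 r) \<longleftrightarrow> 0 \<le> r \<and> (t + x \<bullet> u)\<^sup>2 \<le> r\<^sup>2 - (norm x)\<^sup>2 + (x \<bullet> u)\<^sup>2"
proof -
  \<comment> \<open>Pythagoras: the slice of the ball is centred at parameter
    \<open>- (x \<bullet> u)\<close>.\<close>
  have "(norm (x + t *\<^sub>R u))\<^sup>2 = (t + x \<bullet> u)\<^sup>2 + (norm x)\<^sup>2 - (x \<bullet> u)\<^sup>2"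
    unfolding power2_norm_eq_inner
    using u by (simp add: norm_eq_1 inner_add_left inner_add_right inner_commute
        power2_eq_square algebra_simps)
  moreover have "norm (x + t *\<^sub>R u) \<le> r \<longleftrightarrow> 0 \<le> r \<and> (norm (x + t *\<^sub>R u))\<^sup>2 \<le> r\<^sup>2"
    by (meson norm_ge_zero order_trans power2_le_imp_le power_mono)
  ultimately show ?thesis by (auto simp: slice_def)
qed

text \<open>Both slices are intervals with the same midpoint, so they are nested.\<close>

lemma slice_steiner_cball_nested:
  assumes K: "convex K" and u: "norm u = 1"
  shows "slice u x (steiner u K) \<subseteq> slice u x (cball 0 r) \<or> slice u x (cball 0 r) \<subseteq> slice u x (steiner u K)"
proof (rule ccontr)
  let ?S = "slice u x (steiner u K)"
  assume "\<not> ?thesis"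
  then obtain s t where s: "s \<in> ?S" "s \<notin> slice u x (cball 0 r)"
    and t: "t \<in> slice u x (cball 0 r)" "t \<notin> ?S" by blast
  \<comment> \<open>The point \<open>t\<close> in the ball is nearer to the common midpoint than
    \<open>s\<close> outside it, hence lies between \<open>s\<close> and its mirror image.\<close>
  have "(t + x \<bullet> u)\<^sup>2 < (s + x \<bullet> u)\<^sup>2" using s(2) t(1) unfolding slice_cball[OF u] by linarith
  then have "\<bar>t + x \<bullet> u\<bar> < \<bar>s + x \<bullet> u\<bar>" by (metis abs_le_square_iff linorder_not_le)
  then have "t \<in> closed_segment s (- 2 * (x \<bullet> u) - s)"
    by (auto simp: closed_segment_eq_real_ivl)
  moreover have "closed_segment s (- 2 * (x \<bullet> u) - s) \<subseteq> ?S"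
    using slice_convex[OF steiner_convex[OF K]] s(1) slice_steiner_reflect[OF u s(1)]
    by (simp add: closed_segment_subset)
  ultimately show False using t(2) by blast
qed

text \<open>A translation along \<open>u\<close> maps every line to itself, shifting its parameters
  by \<open>k\<close>.\<close>

lemma emeasure_slice_translate:
  assumes "A \<in> sets borel"
  shows "emeasure lborel (slice u x ((+) (k *\<^sub>R u) ` A)) = emeasure lborel (slice u x A)"
proof -
  have "slice u x ((+) (k *\<^sub>R u) ` A) = (\<lambda>t. 1 * t + k) ` slice u x A"
  proof (intro set_eqI iffI)
    fix t assume "t \<in> slice u x ((+) (k *\<^sub>R u) ` A)"
    then obtain a where "a \<in> A" "x + t *\<^sub>R u = k *\<^sub>R u + a" by (auto simp: slice_def)
    moreover from this(2) have "a = x + (t - k) *\<^sub>R u" by (simp add: algebra_simps)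
    ultimately show "t \<in> (\<lambda>t. 1 * t + k) ` slice u x A"
      by (auto simp: slice_def intro!: image_eqI[of _ _ "t - k"])
  qed (auto simp: slice_def algebra_simps)
  then show ?thesis
    using emeasure_lborel_real_affine[of "slice u x A" 1 k] slice_borel[OF assms] by simp
qed

text \<open>Slices of the left-hand side are no longer than those of \<^term>\<open>K\<close>, and after the translation
  no longer than those of the ball; by nesting, one of these two lengths is that of the
  right-hand side.\<close>

lemma emeasure_steiner_Int_cball_ge:
  fixes K :: "'a::euclidean_space set"
  assumes K: "compact K" "convex K" and u: "norm u = 1"
    and A: "A \<in> sets borel" "A \<subseteq> K - cball 0 r" "(+) (k *\<^sub>R u) ` A \<subseteq> cball 0 r - K"
  shows "emeasure lborel (K \<inter> cball 0 r) + emeasure lborel A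
       \<le> emeasure lborel (steiner u K \<inter> cball 0 r)"
proof -
  let ?B = "cball (0::'a) r" and ?A' = "(+) (k *\<^sub>R u) ` A"
  have Kb: "K \<in> sets borel" "K \<inter> ?B \<in> sets borel" "steiner u K \<in> sets borel"
    using K by (auto intro!: borel_compact steiner_compact compact_Int)
  have "?A' = (\<lambda>x. x - k *\<^sub>R u) -` A"
    by (auto simp: image_iff intro!: bexI[of _ "_ - k *\<^sub>R u"])
  moreover have "(\<lambda>x. x - k *\<^sub>R u) -` A \<in> sets borel"
    using measurable_sets[of "\<lambda>x. x - k *\<^sub>R u" borel borel A] A(1) by simp
  ultimately have A': "?A' \<in> sets borel" by simp
  have "emeasure lborel (K \<inter> ?B \<union> A) \<le> emeasure lborel (steiner u K \<inter> ?B)"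
  proof (rule emeasure_le_of_slice_le[OF u])
    fix x
    let ?e = "\<lambda>S. emeasure lborel (slice u x S)"
    have mono: "?e S \<le> ?e T" if "S \<subseteq> T" "T \<in> sets borel" for S T
      using that slice_borel[OF that(2)] by (intro emeasure_mono) (auto simp: slice_def)
    have add: "?e (S \<union> T) = ?e S + ?e T" if "S \<in> sets borel" "T \<in> sets borel" "S \<inter> T = {}" for S T
    proof -
      have "slice u x (S \<union> T) = slice u x S \<union> slice u x T" "slice u x S \<inter> slice u x T = {}"
        using that(3) by (auto simp: slice_def)
      then show ?thesis using slice_borel that(1,2) by (simp add: plus_emeasure)
    qed
    have 1: "?e (K \<inter> ?B \<union> A) \<le> ?e K" using A(2) Kb by (intro mono) auto
    \<comment> \<open>Since \<open>A\<close> avoids the ball and its translate avoids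
      \<open>K\<close>, both unions with \<open>K \<inter> ?B\<close> are disjoint and lengths
      add.\<close>
    have "?e (K \<inter> ?B \<union> A) = ?e (K \<inter> ?B) + ?e ?A'"
      using A Kb by (subst add) (auto simp: emeasure_slice_translate)
    also have "\<dots> = ?e (K \<inter> ?B \<union> ?A')" using A Kb A' by (subst add) auto
    also have "\<dots> \<le> ?e ?B" using A(3) by (intro mono) auto
    finally have 2: "?e (K \<inter> ?B \<union> A) \<le> ?e ?B" .
    have "slice u x (steiner u K \<inter> ?B) = slice u x (steiner u K) \<inter> slice u x ?B"
      by (auto simp: slice_def)
    then have "?e (steiner u K \<inter> ?B) = ?e (steiner u K) \<or> ?e (steiner u K \<inter> ?B) = ?e ?B"
      using slice_steiner_cball_nested[OF K(2) u, of x r] by (metis inf.absorb1 inf.absorb2)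
    then show "?e (K \<inter> ?B \<union> A) \<le> ?e (steiner u K \<inter> ?B)"
      using 1 2 emeasure_slice_steiner[OF K u] by auto
  qed (use Kb A in auto)
  moreover have "emeasure lborel (K \<inter> ?B \<union> A) = emeasure lborel (K \<inter> ?B) + emeasure lborel A"
    using A Kb by (intro plus_emeasure[symmetric]) auto
  ultimately show ?thesis by simp
qed

text \<open>The integral over \<^term>\<open>h\<close> of the volume of \<^term>\<open>A \<inter> ((+) (- h) ` B)\<close> is the product of the
  volumes, and only \<^term>\<open>h\<close> in a ball of radius \<^term>\<open>2 * R\<close> contribute.\<close>

lemma exists_large_translate_overlap:
  fixes A B :: "'a::euclidean_space set"
  assumes [measurable]: "A \<in> sets borel" "B \<in> sets borel"
    and sub: "A \<subseteq> cball 0 R" "B \<subseteq> cball 0 R"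
    and big: "\<epsilon> * emeasure lborel (cball (0::'a) (2 * R)) < emeasure lborel A * emeasure lborel B"
  obtains h where "\<epsilon> < emeasure lborel {x \<in> A. h + x \<in> B}"
proof -
  have "\<exists>h. \<epsilon> < emeasure lborel {x \<in> A. h + x \<in> B}"
  proof (rule ccontr)
    assume "\<nexists>h. \<epsilon> < emeasure lborel {x \<in> A. h + x \<in> B}"
    then have le: "emeasure lborel {x \<in> A. h + x \<in> B} \<le> \<epsilon>" for h by (simp add: not_less)
    have "emeasure lborel A * emeasure lborel B = (\<integral>\<^sup>+x. indicator A x * emeasure lborel B \<partial>lborel)"
      by (subst nn_integral_multc) auto
    also have "\<dots> = (\<integral>\<^sup>+x. \<integral>\<^sup>+h. indicator A x * indicator B (h + x) \<partial>lborel \<partial>lborel)"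
    proof (rule nn_integral_cong)
      fix x :: 'a
      have "(\<integral>\<^sup>+h. indicator A x * indicator B (h + x) \<partial>lborel)
          = indicator A x * (\<integral>\<^sup>+h. indicator B (x + h) \<partial>lborel)"
        by (subst nn_integral_cmult) (auto simp: add.commute)
      also have "(\<integral>\<^sup>+h. indicator B (x + h) \<partial>lborel) = emeasure lborel B"
        by (subst nn_integral_lborel_translate) auto
      finally show "indicator A x * emeasure lborel B
          = (\<integral>\<^sup>+h. indicator A x * indicator B (h + x) \<partial>lborel)" by simp
    qed
    also have "\<dots> = (\<integral>\<^sup>+h. \<integral>\<^sup>+x. indicator A x * indicator B (h + x) \<partial>lborel \<partial>lborel)"
      by (rule lborel_pair.Fubini') measurable
    also have "\<dots> \<le> (\<integral>\<^sup>+h. \<epsilon> * indicator (cball (0::'a) (2 * R)) h \<partial>lborel)"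
    proof (rule nn_integral_mono)
      fix h :: 'a
      have "(\<integral>\<^sup>+x. indicator A x * indicator B (h + x) \<partial>lborel)
          = (\<integral>\<^sup>+x. indicator {x \<in> A. h + x \<in> B} x \<partial>lborel)"
        by (intro nn_integral_cong) (auto simp: indicator_def)
      also have "\<dots> = emeasure lborel {x \<in> A. h + x \<in> B}"
        by (rule nn_integral_indicator) measurable
      finally have e: "(\<integral>\<^sup>+x. indicator A x * indicator B (h + x) \<partial>lborel)
          = emeasure lborel {x \<in> A. h + x \<in> B}" .
      show "(\<integral>\<^sup>+x. indicator A x * indicator B (h + x) \<partial>lborel) \<le> \<epsilon> * indicator (cball (0::'a) (2 * R)) h"
      proof (cases "h \<in> cball 0 (2 * R)")
        case True
        then show ?thesis using le by (simp add: e)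
      next
        case False
        have "norm h \<le> 2 * R" if "x \<in> A" "h + x \<in> B" for x
          using that sub norm_triangle_ineq4[of "h + x" x] by force
        then have "{x \<in> A. h + x \<in> B} = {}" using False by auto
        then show ?thesis unfolding e by (simp only: emeasure_empty zero_le)
      qed
    qed
    also have "\<dots> = \<epsilon> * emeasure lborel (cball (0::'a) (2 * R))"
      by (rule nn_integral_cmult_indicator) simp
    finally show False using big by simp
  qed
  then show ?thesis using that by blast
qed

section \<open>Inscribed symmetric polytopes under symmetrization\<close>

definition inscribed :: "nat \<Rightarrow> 'a::euclidean_space \<Rightarrow> 'a set \<Rightarrow> 'a set \<Rightarrow> bool" where
  "inscribed m c K P \<longleftrightarrow>
     (\<exists>S. finite S \<and> card S \<le> m \<and> P = convex hull S \<and> P \<subseteq> K \<and> symmetric_about c P)"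

lemma symmetric_about_0: "symmetric_about 0 P \<longleftrightarrow> (\<forall>x\<in>P. - x \<in> P)"
  by (simp add: symmetric_about_def)

lemma symmetric_about_convex_hull:
  fixes S :: "'a::euclidean_space set"
  assumes "\<And>x. x \<in> S \<Longrightarrow> - x \<in> S"
  shows "symmetric_about 0 (convex hull S)"
proof -
  have "uminus ` S = S" using assms by (force simp: image_iff)
  moreover have "uminus ` (convex hull S) = convex hull (uminus ` S)"
    by (rule convex_hull_linear_image) (simp add: linear_iff)
  ultimately have "uminus ` (convex hull S) = convex hull S" by simp
  then show ?thesis unfolding symmetric_about_0 by blast
qed

lemma inscribed_compact: "inscribed m c K P \<Longrightarrow> compact P"
  by (auto simp: inscribed_def finite_imp_compact_convex_hull)

text \<open>The spanning set in \<open>inscribed\<close> need not be symmetric, but the extreme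
  points are: negation permutes them. They lie in every spanning set, and their hull is
  \<open>P\<close>. Odd parts require this pairing of \<open>v\<close> with
  \<open>- v\<close>.\<close>

lemma inscribed_symmetric_vertices:
  fixes P :: "'a::euclidean_space set"
  assumes "inscribed m 0 K P"
  obtains T where "finite T" "card T \<le> m" "P = convex hull T" "\<And>x. x \<in> T \<Longrightarrow> - x \<in> T"
proof -
  obtain S where S: "finite S" "card S \<le> m" "P = convex hull S" and sym: "\<And>x. x \<in> P \<Longrightarrow> - x \<in> P"
    using assms unfolding inscribed_def symmetric_about_0 by blast
  define T where "T = {x. x extreme_point_of P}"
  have sub: "T \<subseteq> S" unfolding T_def S(3) by (rule extreme_points_of_convex_hull)
  have "- x \<in> T" if "x \<in> T" for x
  proof -
    have x: "x \<in> P" "\<And>a b. a \<in> P \<Longrightarrow> b \<in> P \<Longrightarrow> x \<notin> open_segment a b"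
      using that by (auto simp: T_def extreme_point_of_def)
    have "- x \<notin> open_segment a b" if "a \<in> P" "b \<in> P" for a b
    proof
      assume "- x \<in> open_segment a b"
      then obtain t where t: "a \<noteq> b" "0 < t" "t < 1" "- x = (1 - t) *\<^sub>R a + t *\<^sub>R b"
        by (auto simp: in_segment)
      have "x = - (- x)" by simp
      also have "\<dots> = (1 - t) *\<^sub>R (- a) + t *\<^sub>R (- b)" unfolding t(4) by simp
      finally have "x \<in> open_segment (- a) (- b)" using t(1-3) by (auto simp: in_segment)
      then show False using x(2) sym that by blast
    qed
    then show ?thesis using sym x(1) by (simp add: T_def extreme_point_of_def)
  qed
  moreover have "P = convex hull T" unfolding T_def S(3) by (rule Krein_Milman_polytope[OF S(1)])
  moreover have "finite T" "card T \<le> m"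
    using sub S finite_subset card_mono[OF S(1) sub] by auto
  ultimately show ?thesis using that by blast
qed

text \<open>A polytope in the symmetral with vertices \<^term>\<open>v\<close> is a subset of the fibrewise average of the
  hulls of points \<^term>\<open>p v\<close> and reflected points \<^term>\<open>q v\<close> with \<^term>\<open>p v\<close>, \<^term>\<open>q v\<close> in \<^term>\<open>K\<close>.
  Passing to odd parts in \<^term>\<open>v\<close> makes both hulls symmetric.\<close>

lemma inscribed_steiner:
  fixes K :: "'a::euclidean_space set"
  assumes K: "compact K" "convex K" "\<And>x. x \<in> K \<Longrightarrow> - x \<in> K" and u: "norm u = 1"
    and P: "inscribed m 0 (steiner u K) P"
  obtains Q where "inscribed m 0 K Q" "emeasure lborel P \<le> emeasure lborel Q"
proof -
  obtain T where T: "finite T" "card T \<le> m" "P = convex hull T" "\<And>x. x \<in> T \<Longrightarrow> - x \<in> T"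
    using inscribed_symmetric_vertices P by metis
  have "T \<subseteq> steiner u K" using P T(3) hull_subset[of T convex] by (auto simp: inscribed_def)
  then have "\<forall>v\<in>T. \<exists>p q. p \<in> K \<and> q \<in> K \<and> v = (1/2) *\<^sub>R (p + reflect u q) \<and> p - reflect u q \<in> span {u}"
    using steinerE by (metis subsetD)
  then obtain p0 q0 where pq0: "\<And>v. v \<in> T \<Longrightarrow> p0 v \<in> K" "\<And>v. v \<in> T \<Longrightarrow> q0 v \<in> K"
    "\<And>v. v \<in> T \<Longrightarrow> v = (1/2) *\<^sub>R (p0 v + reflect u (q0 v))"
    "\<And>v. v \<in> T \<Longrightarrow> p0 v - reflect u (q0 v) \<in> span {u}" by metis
  \<comment> \<open>Half of \<open>f v\<close> plus half of \<open>- f (- v)\<close>: in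
    \<open>K\<close> by symmetry and convexity.\<close>
  define odd_part where "odd_part f v = (1/2) *\<^sub>R (f v - f (- v))" for f :: "'a \<Rightarrow> 'a" and v
  define p where "p = odd_part p0"
  define q where "q = odd_part q0"
  have odd_part_in: "odd_part f v \<in> K" if "\<And>v. v \<in> T \<Longrightarrow> f v \<in> K" "v \<in> T" for f v
  proof -
    have "(1/2) *\<^sub>R f v + (1/2) *\<^sub>R (- f (- v)) \<in> K"
      using that T(4) K by (intro convexD) auto
    then show ?thesis by (simp add: odd_part_def algebra_simps)
  qed
  have odd_part_minus: "odd_part f (- v) = - odd_part f v" for f v
    by (simp add: odd_part_def algebra_simps)
  have hull: "inscribed m 0 K (convex hull (odd_part f ` T))" if "\<And>v. v \<in> T \<Longrightarrow> f v \<in> K" for f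
  proof -
    have "symmetric_about 0 (convex hull (odd_part f ` T))"
    proof (rule symmetric_about_convex_hull)
      fix x assume "x \<in> odd_part f ` T"
      then obtain v where "v \<in> T" "x = odd_part f v" by blast
      then show "- x \<in> odd_part f ` T" using T(4) odd_part_minus by (metis imageI)
    qed
    moreover have "convex hull (odd_part f ` T) \<subseteq> K"
      using odd_part_in[of f] that K(2) by (intro hull_minimal) auto
    moreover have "card (odd_part f ` T) \<le> m" using card_image_le[OF T(1)] T(2) le_trans by blast
    ultimately show ?thesis unfolding inscribed_def using T(1) by blast
  qed
  have refl: "reflect u (q v) = (1/2) *\<^sub>R (reflect u (q0 v) - reflect u (q0 (- v)))" for v
    by (simp add: q_def odd_part_def linear_cmul[OF linear_reflect] linear_diff[OF linear_reflect])
  let ?A = "convex hull (p ` T)" and ?Q = "convex hull (q ` T)"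
  have cpt: "compact ?A" "compact ?Q" using T(1) by (auto intro: finite_imp_compact_convex_hull)
  \<comment> \<open>Half the difference of the representations of \<open>v\<close> and
    \<open>- v\<close> represents \<open>v\<close> again, now by odd parts.\<close>
  have "v \<in> fibre_avg u ?A (reflect u ` ?Q)" if v: "v \<in> T" for v
  proof (rule fibre_avgI)
    show "p v \<in> ?A" "reflect u (q v) \<in> reflect u ` ?Q" using v by (auto intro: hull_inc)
    have "p v - reflect u (q v)
        = (1/2) *\<^sub>R ((p0 v - reflect u (q0 v)) - (p0 (- v) - reflect u (q0 (- v))))"
      by (simp add: refl p_def odd_part_def algebra_simps)
    then show "p v - reflect u (q v) \<in> span {u}"
      using pq0(4)[OF v] pq0(4)[OF T(4)[OF v]] by (simp only: span_scale span_diff)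
    have "v = (1/2) *\<^sub>R (v - (- v))" by (simp add: scaleR_2[symmetric])
    also have "v - (- v) = (1/2) *\<^sub>R (p0 v + reflect u (q0 v)) - (1/2) *\<^sub>R (p0 (- v) + reflect u (q0 (- v)))"
      using pq0(3)[OF v] pq0(3)[OF T(4)[OF v]] by (rule arg_cong2)
    also have "\<dots> = p v + reflect u (q v)"
      by (simp add: refl p_def odd_part_def algebra_simps)
    finally show "v = (1/2) *\<^sub>R (p v + reflect u (q v))" .
  qed
  then have "P \<subseteq> fibre_avg u ?A (reflect u ` ?Q)"
    unfolding T(3) by (intro hull_minimal fibre_avg_convex convex_reflect) auto
  then have "emeasure lborel P \<le> emeasure lborel (fibre_avg u ?A (reflect u ` ?Q))"
    using cpt by (intro emeasure_mono) (auto intro!: borel_compact fibre_avg_compact compact_reflect)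
  then have "2 * emeasure lborel P \<le> 2 * emeasure lborel (fibre_avg u ?A (reflect u ` ?Q))"
    by (intro mult_left_mono) auto
  also have "\<dots> \<le> emeasure lborel ?A + emeasure lborel (reflect u ` ?Q)"
    using cpt by (intro emeasure_fibre_avg_le compact_reflect convex_reflect u) auto
  also have "\<dots> = emeasure lborel ?A + emeasure lborel ?Q" using emeasure_reflect[OF u cpt(2)] by simp
  \<comment> \<open>The larger of the two hulls is therefore at least as large as
    \<open>P\<close>.\<close>
  also have "\<dots> \<le> 2 * max (emeasure lborel ?A) (emeasure lborel ?Q)"
    unfolding mult_2 by (intro add_mono) auto
  finally have "emeasure lborel P \<le> max (emeasure lborel ?A) (emeasure lborel ?Q)"
    by (simp add: ennreal_mult_le_mult_iff)
  moreover have "inscribed m 0 K ?A" "inscribed m 0 K ?Q"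
    unfolding p_def q_def using hull pq0(1,2) by auto
  ultimately show ?thesis using that by (metis max_def)
qed

section \<open>Approaching the ball\<close>

lemma measure_lebesgue_compact: "compact S \<Longrightarrow> measure lebesgue S = measure lborel S"
  by (simp add: borel_compact)

lemma emeasure_lborel_bounded:
  fixes S :: "'a::euclidean_space set"
  shows "bounded S \<Longrightarrow> emeasure lborel S = ennreal (measure lborel S)"
  using emeasure_bounded_finite[of S] by (intro emeasure_eq_ennreal_measure) auto

text \<open>A near-maximizer of the volume of \<open>L \<inter> ?B\<close> replaces a convergent
  sequence of symmetrals. If it missed the ball by \<open>\<delta>\<close>, one more symmetrization
  would push that volume above its supremum.\<close>

lemma exists_inscribed_dominated_close_to_ball:
  fixes K :: "'a::euclidean_space set"
  assumes K: "compact K" "convex K" "\<And>x. x \<in> K \<Longrightarrow> - x \<in> K"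
    and vol: "measure lborel (cball (0::'a) r) = measure lborel K" and "0 < \<delta>"
  obtains L :: "'a set" where "compact L" "convex L"
    "\<forall>P. inscribed m 0 L P \<longrightarrow> (\<exists>Q. inscribed m 0 K Q \<and> emeasure lborel P \<le> emeasure lborel Q)"
    "measure lborel (cball 0 r - L) < \<delta>"
proof -
  let ?B = "cball (0::'a) r"
  obtain R0 where R0: "0 < R0" "K \<subseteq> cball 0 R0"
    using compact_imp_bounded[OF K(1)] by (metis bounded_subset_ballD ball_subset_cball order_trans)
  \<comment> \<open>Large enough to hold both \<open>K\<close> and the ball.\<close>
  define R where "R = max R0 r"
  have R: "0 < R" "K \<subseteq> cball 0 R" "r \<le> R" using R0 by (auto simp: R_def)
  \<comment> \<open>Properties of \<open>K\<close> that survive symmetrization; the last one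
    composes along iterates.\<close>
  define C where "C L \<longleftrightarrow> compact L \<and> convex L \<and> (\<forall>x\<in>L. - x \<in> L) \<and> L \<subseteq> cball 0 R \<and>
      measure lborel L = measure lborel ?B \<and>
      (\<forall>P. inscribed m 0 L P \<longrightarrow> (\<exists>Q. inscribed m 0 K Q \<and> emeasure lborel P \<le> emeasure lborel Q))"
    for L :: "'a set"
  define f where "f L = measure lborel (L \<inter> ?B)" for L
  have C_steiner: "C (steiner u L)" if "C L" "norm u = 1" for L u
  proof -
    have L: "compact L" "convex L" "\<And>x. x \<in> L \<Longrightarrow> - x \<in> L" "L \<subseteq> cball 0 R"
      using that(1) by (auto simp: C_def)
    have "\<exists>Q. inscribed m 0 K Q \<and> emeasure lborel P \<le> emeasure lborel Q"
      if P: "inscribed m 0 (steiner u L) P" for P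
    proof -
      obtain Q' where Q': "inscribed m 0 L Q'" "emeasure lborel P \<le> emeasure lborel Q'"
        using inscribed_steiner[OF L(1-3) \<open>norm u = 1\<close> P] by blast
      then obtain Q where "inscribed m 0 K Q" "emeasure lborel Q' \<le> emeasure lborel Q"
        using \<open>C L\<close> by (auto simp: C_def)
      then show ?thesis using Q'(2) order_trans by blast
    qed
    moreover have "measure lborel (steiner u L) = measure lborel L"
      using emeasure_steiner[OF L(1,2) that(2)] by (simp add: measure_def)
    ultimately show ?thesis
      using that(1) steiner_compact[OF L(1)] steiner_convex[OF L(2)] steiner_subset_cball[OF L(4) that(2)]
        steiner_uminus[OF L(3)]
      by (auto simp: C_def)
  qed
  have "\<exists>L. C L \<and> measure lborel (?B - L) < \<delta>"
  proof (rule ccontr)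
    assume "\<nexists>L. C L \<and> measure lborel (?B - L) < \<delta>"
    then have far: "\<delta> \<le> measure lborel (?B - L)" if "C L" for L using that by force
    define W where "W = measure lborel (cball (0::'a) (2 * R))"
    have W: "0 < W" using R(1) by (simp add: W_def)
    \<comment> \<open>The two differences have volume product at least
      \<open>\<delta> * \<delta>\<close>, spread over translations in a ball of volume
      \<open>W\<close>; the factor 2 makes the bound strict.\<close>
    define \<epsilon> where "\<epsilon> = \<delta>\<^sup>2 / (2 * W)"
    have \<epsilon>: "0 < \<epsilon>" "\<epsilon> * W < \<delta> * \<delta>" using W assms(5) by (auto simp: \<epsilon>_def power2_eq_square)
    have CK: "C K" using K R(2) vol by (auto simp: C_def)
    have bdd: "bdd_above (f ` Collect C)"
    proof (rule bdd_aboveI2)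
      fix L assume "L \<in> Collect C"
      then have "compact L" by (simp add: C_def)
      then show "f L \<le> measure lborel ?B"
        unfolding f_def by (intro measure_mono_fmeasurable) (auto simp: borel_compact fmeasurable_compact)
    qed
    obtain L where L: "C L" "(SUP L\<in>Collect C. f L) - \<epsilon> < f L"
      using less_cSup_iff[THEN iffD1, OF _ bdd, of "(SUP L\<in>Collect C. f L) - \<epsilon>"] CK \<epsilon>(1) by auto
    have Lc: "compact L" "convex L" "L \<subseteq> cball 0 R" "measure lborel L = measure lborel ?B"
      using L(1) by (auto simp: C_def)
    have Lb [measurable]: "L \<in> sets borel" by (rule borel_compact[OF Lc(1)])
    have fin: "L \<in> fmeasurable lborel" "?B \<in> fmeasurable lborel"
      using Lc(1) by (auto simp: fmeasurable_compact)
    have diff: "measure lborel (S - T) = measure lborel S - measure lborel (S \<inter> T)"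
      if "S \<in> fmeasurable lborel" "T \<in> fmeasurable lborel" for S T :: "'a set"
    proof -
      have "S - T = S - (S \<inter> T)" by blast
      then show ?thesis
        using that measure_Diff[of lborel S "S \<inter> T"] by (auto simp: fmeasurable_def)
    qed
    have "measure lborel (L - ?B) = measure lborel L - f L" "measure lborel (?B - L) = measure lborel ?B - f L"
      unfolding f_def diff[OF fin] diff[OF fin(2,1)] by (simp_all add: Int_commute)
    \<comment> \<open>Equal volumes make the two differences equally large.\<close>
    then have eq: "\<delta> \<le> measure lborel (L - ?B)" "\<delta> \<le> measure lborel (?B - L)"
      using far[OF L(1)] Lc(4) by auto
    have meas: "L - ?B \<in> sets borel" "?B - L \<in> sets borel" by auto
    have sub: "L - ?B \<subseteq> cball 0 R" "?B - L \<subseteq> cball 0 R" using Lc(3) R(3) by auto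
    have bd: "bounded (L - ?B)" "bounded (?B - L)" using sub bounded_cball bounded_subset by blast+
    have "\<epsilon> * W < measure lborel (L - ?B) * measure lborel (?B - L)"
      using \<epsilon>(2) mult_mono[OF eq] assms(5) by simp
    then have "ennreal \<epsilon> * emeasure lborel (cball (0::'a) (2 * R))
        < emeasure lborel (L - ?B) * emeasure lborel (?B - L)"
      using \<epsilon>(1) W by (simp add: emeasure_lborel_bounded[OF bd(1)] emeasure_lborel_bounded[OF bd(2)]
          emeasure_lborel_bounded[OF bounded_cball] W_def[symmetric] ennreal_mult[symmetric] ennreal_less_iff)
    then obtain h where h: "ennreal \<epsilon> < emeasure lborel {x \<in> L - ?B. h + x \<in> ?B - L}"
      using exists_large_translate_overlap[OF meas sub] by blast
    define A where "A = {x \<in> L - ?B. h + x \<in> ?B - L}"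
    have "{x \<in> S. h + x \<in> T} \<in> sets borel"
      if [measurable]: "S \<in> sets borel" "T \<in> sets borel" for S T by measurable
    then have Ab: "A \<in> sets borel" unfolding A_def using meas by blast
    \<comment> \<open>The two differences are disjoint, so the zero translation has no overlap.
      Hence \<open>h\<close> has a direction to symmetrize in.\<close>
    have "h \<noteq> 0"
    proof
      assume "h = 0"
      then have "A = {}" by (auto simp: A_def)
      then show False using h unfolding A_def[symmetric] by simp
    qed
    define u where "u = (1 / norm h) *\<^sub>R h"
    have u: "norm u = 1" "norm h *\<^sub>R u = h" using \<open>h \<noteq> 0\<close> by (auto simp: u_def)
    have "emeasure lborel (L \<inter> ?B) + emeasure lborel A \<le> emeasure lborel (steiner u L \<inter> ?B)"
      using Ab u by (intro emeasure_steiner_Int_cball_ge[OF Lc(1,2) u(1), of _ _ "norm h"])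
        (auto simp: A_def)
    moreover have bd': "bounded (L \<inter> ?B)" "bounded (steiner u L \<inter> ?B)" by (auto intro: bounded_Int)
    moreover have "ennreal \<epsilon> \<le> emeasure lborel A" using h by (simp add: A_def)
    ultimately have "ennreal (f L) + ennreal \<epsilon> \<le> ennreal (f (steiner u L))"
      unfolding f_def using emeasure_lborel_bounded[OF bd'(1)] emeasure_lborel_bounded[OF bd'(2)]
      by (metis add_left_mono order_trans)
    then have "f L + \<epsilon> \<le> f (steiner u L)"
      using \<epsilon>(1) by (simp add: f_def ennreal_plus[symmetric] del: ennreal_plus)
    moreover have "f (steiner u L) \<le> (SUP L\<in>Collect C. f L)"
      using C_steiner[OF L(1) u(1)] by (intro cSUP_upper bdd) simp
    ultimately show False using L(2) by simp
  qed
  then show ?thesis using that by (auto simp: C_def)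
qed

text \<open>Otherwise a separating hyperplane cuts a ball of radius \<^term>\<open>\<eta> / 2\<close> out of \<^term>\<open>cball 0 r - L\<close>.\<close>

lemma cball_subset_of_measure_Diff_less:
  fixes L :: "'a::euclidean_space set"
  assumes L: "closed L" "convex L" and "0 < \<eta>"
    and small: "measure lborel (cball 0 r - L) < measure lborel (cball (0::'a) (\<eta> / 2))"
  shows "cball 0 (r - \<eta>) \<subseteq> L"
proof (rule ccontr)
  assume "\<not> ?thesis"
  then obtain x where x: "norm x \<le> r - \<eta>" "x \<notin> L" by (metis mem_cball_0 subsetI)
  obtain a b where ab: "a \<bullet> x < b" "\<And>y. y \<in> L \<Longrightarrow> b < a \<bullet> y"
    using separating_hyperplane_closed_point[OF L(2,1) x(2)] by auto
  \<comment> \<open>Moving from \<open>x\<close> by \<open>\<eta> / 2\<close> away from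
    \<open>L\<close> gives a ball whose points \<open>y\<close> all satisfy
    \<open>a \<bullet> y \<le> a \<bullet> x\<close>. With \<open>sgn 0 = 0\<close> this also covers
    \<open>a = 0\<close>, which forces \<open>L\<close> to be empty.\<close>
  define z where "z = x - (\<eta> / 2) *\<^sub>R sgn a"
  have sa: "norm (sgn a) \<le> 1" "a \<bullet> sgn a = norm a"
    by (cases "a = 0"; simp add: sgn_div_norm flip: power2_norm_eq_inner; simp add: power2_eq_square)+
  have "cball z (\<eta> / 2) \<subseteq> cball 0 r - L"
  proof
    fix y assume "y \<in> cball z (\<eta> / 2)"
    then have y: "norm (y - z) \<le> \<eta> / 2" by (simp add: dist_norm norm_minus_commute)
    have "norm ((\<eta> / 2) *\<^sub>R sgn a) \<le> \<eta> / 2" using sa(1) \<open>0 < \<eta>\<close> by simp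
    then have "norm z \<le> norm x + \<eta> / 2"
      unfolding z_def using norm_triangle_ineq4[of x "(\<eta> / 2) *\<^sub>R sgn a"] by linarith
    then have "norm y \<le> r" using y x(1) norm_triangle_ineq[of z "y - z"] by simp
    moreover have "a \<bullet> (y - z) \<le> norm a * (\<eta> / 2)"
      using norm_cauchy_schwarz[of a "y - z"] mult_left_mono[OF y, of "norm a"] by simp
    then have "a \<bullet> y \<le> a \<bullet> x" by (simp add: z_def inner_diff_right sa(2) algebra_simps)
    then have "y \<notin> L" using ab by force
    ultimately show "y \<in> cball 0 r - L" by simp
  qed
  then have "measure lborel (cball z (\<eta> / 2)) \<le> measure lborel (cball 0 r - L)"
    using L(1) by (intro measure_mono_fmeasurable fmeasurable_Diff) (auto simp: fmeasurable_compact)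
  then show False using small \<open>0 < \<eta>\<close> by (simp add: content_cball)
qed

section \<open>Affine images and the comparison of \<open>psi\<close>\<close>

text \<open>Affine maps commute with hulls and carry point reflections along. This serves both
  scaling and recentring.\<close>

lemma inscribed_affine_image:
  fixes P :: "'a::euclidean_space set"
  assumes "inscribed m a K P" "(\<lambda>x. k *\<^sub>R x + d) ` P \<subseteq> K'"
  shows "inscribed m (k *\<^sub>R a + d) K' ((\<lambda>x. k *\<^sub>R x + d) ` P)"
proof -
  let ?f = "\<lambda>x. k *\<^sub>R x + d"
  obtain S where S: "finite S" "card S \<le> m" "P = convex hull S" "symmetric_about a P"
    using assms by (auto simp: inscribed_def)
  have "?f ` P = convex hull (?f ` S)"
    unfolding S(3) using convex_hull_affinity[of d k S] by (simp add: add.commute)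
  moreover have "symmetric_about (k *\<^sub>R a + d) (?f ` P)"
  proof -
    have "2 *\<^sub>R (k *\<^sub>R a + d) - ?f x = ?f (2 *\<^sub>R a - x)" for x
      unfolding scaleR_2 by (simp add: algebra_simps)
    then show ?thesis using S(4) by (auto simp: symmetric_about_def)
  qed
  moreover have "card (?f ` S) \<le> m" using card_image_le[OF S(1), of ?f] S(2) by simp
  ultimately show ?thesis unfolding inscribed_def using S(1) assms(2) by blast
qed

lemma psi_eq: "psi m c K = Sup {measure lebesgue P / measure lebesgue K |P. inscribed m c K P}"
  by (simp add: psi_def inscribed_def)

text \<open>A real \<open>Sup\<close> bounds its members once the set is bounded above. Here 1 is a
  bound by \<open>P \<subseteq> K\<close>, also for null \<open>K\<close>, where the quotient is
  0.\<close>

lemma psi_upper: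
  fixes K :: "'a::euclidean_space set"
  assumes "compact K" "inscribed m c K P"
  shows "measure lebesgue P / measure lebesgue K \<le> psi m c K"
  unfolding psi_eq
proof (rule cSup_upper)
  have "measure lebesgue P \<le> measure lebesgue K" if "inscribed m c K P" for P
    using that inscribed_compact[OF that] assms(1)
    by (intro measure_mono_fmeasurable) (auto simp: inscribed_def lmeasurable_compact fmeasurableD)
  then show "bdd_above {measure lebesgue P / measure lebesgue K |P. inscribed m c K P}"
    by (intro bdd_aboveI[of _ 1]) (auto simp: divide_le_eq_1 measure_nonneg zero_less_measure_iff)
qed (use assms in auto)

theorem theorem6:
  fixes K :: "'a::euclidean_space set" and c :: 'a and m :: nat
  assumes "convex_body K" and "symmetric_about c K"
  shows "psi m c K \<ge> psi m 0 (cball (0::'a) 1)"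
proof -
  define N where "N = DIM('a)"
  \<comment> \<open>Recentring at the origin, in the form the affine lemmas expect.\<close>
  define K0 where "K0 = (\<lambda>x. 1 *\<^sub>R x + (- c)) ` K"
  have K: "compact K" "convex K" "interior K \<noteq> {}" using assms(1) by (auto simp: convex_body_def)
  have K0_eq: "K0 = (+) (- c) ` K" by (simp add: K0_def add.commute)
  have K0: "compact K0" "convex K0" unfolding K0_eq using K compact_translation convex_translation by blast+
  have K0_sym: "- x \<in> K0" if x: "x \<in> K0" for x
  proof -
    obtain y where "y \<in> K" "x = y - c" using x by (auto simp: K0_def)
    then show ?thesis using assms(2)
      by (auto simp: K0_def symmetric_about_def scaleR_2 intro!: image_eqI[of _ _ "2 *\<^sub>R c - y"])
  qed
  have volK0: "measure lborel K0 = measure lebesgue K"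
    using measure_lebesgue_affine[of 1 "- c" K]
    unfolding K0_def[symmetric] measure_lebesgue_compact[OF K0(1)] by simp
  have "0 < measure lebesgue K"
  proof -
    obtain x e where e: "0 < e" "cball x e \<subseteq> K"
      using K(3) by (metis equals0I mem_interior_cball)
    have "measure lebesgue (cball x e) \<le> measure lebesgue K"
      using e K(1) by (intro measure_mono_fmeasurable) (auto simp: lmeasurable_compact fmeasurableD)
    moreover have "0 < measure lebesgue (cball x e)" using e(1) by (simp add: measure_lebesgue_compact)
    ultimately show ?thesis by linarith
  qed
  define V where "V = measure lebesgue (cball (0::'a) 1)"
  have V: "0 < V" by (simp add: V_def measure_lebesgue_compact)
  \<comment> \<open>The radius at which the ball has the volume of \<open>K\<close>.\<close>
  define r where "r = root N (measure lebesgue K / V)"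
  have N: "0 < N" by (simp add: N_def)
  have r: "0 < r" "r ^ N = measure lebesgue K / V"
    unfolding r_def using N V \<open>0 < measure lebesgue K\<close> by (auto simp: real_root_gt_zero)
  have volr: "measure lborel (cball (0::'a) r) = measure lborel K0"
  proof -
    have "unit_ball_vol (real N) = V" by (simp add: V_def N_def measure_lebesgue_compact content_cball)
    then show ?thesis using r V by (simp add: content_cball volK0 N_def[symmetric])
  qed
  have "measure lebesgue P / V \<le> psi m c K" if P: "inscribed m 0 (cball (0::'a) 1) P" for P
  proof -
    \<comment> \<open>A dominated body \<open>L\<close> is only known to contain balls of radius
      below \<open>r\<close>; this costs the factor \<open>t ^ N\<close>.\<close>
    have key: "t ^ N * (measure lebesgue P / V) \<le> psi m c K" if t: "0 < t" "t < 1" for t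
    proof -
      define \<eta> where "\<eta> = (1 - t) * r"
      have \<eta>: "0 < \<eta>" "r - \<eta> = t * r" using t r(1) by (auto simp: \<eta>_def algebra_simps)
      then have pos: "0 < measure lborel (cball (0::'a) (\<eta> / 2))" by simp
      obtain L :: "'a set" where L: "compact L" "convex L"
        "\<forall>P. inscribed m 0 L P \<longrightarrow> (\<exists>Q. inscribed m 0 K0 Q \<and> emeasure lborel P \<le> emeasure lborel Q)"
        "measure lborel (cball 0 r - L) < measure lborel (cball (0::'a) (\<eta> / 2))"
        using exists_inscribed_dominated_close_to_ball[where m = m, OF K0 K0_sym volr pos] by blast
      have sub: "cball 0 (t * r) \<subseteq> L"
        using cball_subset_of_measure_Diff_less[OF compact_imp_closed[OF L(1)] L(2) \<eta>(1) L(4)]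
        by (simp add: \<eta>(2))
      define P' where "P' = (\<lambda>x. (t * r) *\<^sub>R x + 0) ` P"
      have "P' \<subseteq> cball 0 (t * r)"
        using P t r(1) by (auto simp: P'_def inscribed_def abs_mult intro!: mult_left_le)
      then have P': "inscribed m 0 L P'"
        using inscribed_affine_image[OF P, of "t * r" 0 L] sub by (simp add: P'_def)
      then obtain Q where Q: "inscribed m 0 K0 Q" "emeasure lborel P' \<le> emeasure lborel Q"
        using L(3) by blast
      define Q' where "Q' = (\<lambda>x. 1 *\<^sub>R x + c) ` Q"
      have "Q' \<subseteq> K" using Q(1) by (auto simp: Q'_def inscribed_def K0_def)
      then have Q': "inscribed m c K Q'"
        using inscribed_affine_image[OF Q(1), of 1 c K] by (simp add: Q'_def)
      have cpt: "compact P" "compact P'" "compact Q" "compact Q'"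
        using P P' Q(1) Q' inscribed_compact by blast+
      have "(t * r) ^ N * measure lebesgue P = measure lebesgue P'"
        using measure_lebesgue_affine[of "t * r" 0 P] t r(1) by (simp add: P'_def N_def abs_mult)
      also have "\<dots> \<le> measure lebesgue Q"
        using Q(2) emeasure_lborel_bounded[OF compact_imp_bounded[OF cpt(2)]]
          emeasure_lborel_bounded[OF compact_imp_bounded[OF cpt(3)]] cpt
        by (simp add: measure_lebesgue_compact)
      also have "\<dots> = measure lebesgue Q'"
        using measure_lebesgue_affine[of 1 c Q] by (simp add: Q'_def)
      finally have "(t * r) ^ N * measure lebesgue P / measure lebesgue K
          \<le> measure lebesgue Q' / measure lebesgue K"
        by (intro divide_right_mono) auto
      also have "\<dots> \<le> psi m c K" by (rule psi_upper[OF K(1) Q'])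
      finally show ?thesis
        using \<open>0 < measure lebesgue K\<close> V by (simp add: power_mult_distrib r(2) field_simps)
    qed
    \<comment> \<open>Letting \<open>t\<close> tend to 1 from below removes the factor.\<close>
    have "((\<lambda>t. t ^ N * (measure lebesgue P / V)) \<longlongrightarrow> 1 ^ N * (measure lebesgue P / V)) (at_left 1)"
      by (intro tendsto_intros)
    then have "1 ^ N * (measure lebesgue P / V) \<le> psi m c K"
    proof (rule tendsto_upperbound)
      show "\<forall>\<^sub>F t in at_left 1. t ^ N * (measure lebesgue P / V) \<le> psi m c K"
        unfolding eventually_at_left_field using key by (intro exI[of _ 0]) auto
    qed simp
    then show ?thesis by simp
  qed
  \<comment> \<open>The least-upper-bound rule needs a competitor; the empty hull works even for
    \<open>m = 0\<close>.\<close>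
  moreover have "inscribed m 0 (cball (0::'a) 1) {}"
    by (auto simp: inscribed_def symmetric_about_def intro!: exI[of _ "{}"])
  ultimately show ?thesis
    unfolding psi_eq[of m 0] V_def[symmetric] by (intro cSup_least) auto
qed

end
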